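(* Let $p$ be an odd prime, let $\lambda\in\mathbb{C}_p$ with $|\lambda|_p\ge1$, and let $a\in\frac{1}{\lambda}E$ with $a\neq0$. Then \[ \frac{\lambda a}{\log(1+\lambda a)}\int_{\mathbb{Z}_p}\cosh_\lambda(x:a)\,d\mu(x)=\frac{a}{2}\coth_\lambda\Big(\frac12:a\Big), \qquad \frac{\lambda a}{\log(1+\lambda a)}\int_{\mathbb{Z}_p}\sinh_\lambda(x:a)\,d\mu(x)=-\frac{a}{2}. \]
   Context: $\mathbb{C}_p$ is the completion of an algebraic closure of $\mathbb{Q}_p$, with $|p|_p=1/p$; $\mathbb{Z}_p$ is the ring of $p$-adic integers. Let $E=\{x\in\mathbb{C}_p: |x|_p<p^{-1/(p-1)}\}$ and $\frac{1}{\lambda}E=\{t\in\mathbb{C}_p:\lambda t\in E\}$. Let $\log$ and $\exp$ denote the $p$-adic logarithm and exponential. For $a\in\frac1\lambda E$ and $|x|_p\le|\lambda|_p$, the degenerate exponential is $e^x_\lambda(a)=(1+\lambda a)^{x/\lambda}=\exp\big(\tfrac{x}{\lambda}\log(1+\lambda a)\big)=\sum_{n\ge0}(x)_{n,\lambda}\frac{a^n}{n!}$, where $(x)_{0,\lambda}=1$ and $(x)_{n,\lambda}=x(x-\lambda)\cdots(x-(n-1)\lambda)$ for $n\ge1$. The degenerate hyperbolic functions are $\cosh_\lambda(x:a)=\frac12\big(e^x_\lambda(a)+e^{-x}_\lambda(a)\big)$, $\sinh_\lambda(x:a)=\frac12\big(e^x_\lambda(a)-e^{-x}_\lambda(a)\big)$,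 and $\coth_\lambda(x:a)=\cosh_\lambda(x:a)/\sinh_\lambda(x:a)$ (for $x\neq0$, $a\neq0$). The Volkenborn integral of a uniformly differentiable $f:\mathbb{Z}_p\to\mathbb{C}_p$ is $\int_{\mathbb{Z}_p}f(x)\,d\mu(x)=\lim_{N\to\infty}p^{-N}\sum_{x=0}^{p^N-1}f(x)$. *)

theory Defs
  imports "HOL-Analysis.Analysis" "HOL-Computational_Algebra.Computational_Algebra"
begin

class ultrametric_field = field_char_0 + metric_space +
  fixes vabs :: "'a \<Rightarrow> real"
  assumes dist_vabs: "dist x y = vabs (x - y)"
    and vabs_add_le_max: "vabs (x + y) \<le> max (vabs x) (vabs y)"
    and vabs_mult: "vabs (x * y) = vabs x * vabs y"

definition is_subfield :: "'a::field set \<Rightarrow> bool" where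
  "is_subfield K \<longleftrightarrow> 0 \<in> K \<and> 1 \<in> K \<and>
     (\<forall>x\<in>K. \<forall>y\<in>K. x + y \<in> K \<and> x * y \<in> K) \<and> (\<forall>x\<in>K. - x \<in> K \<and> inverse x \<in> K)"

definition is_algebraic_closure_of :: "'a::field set \<Rightarrow> 'a set \<Rightarrow> bool" where
  "is_algebraic_closure_of A K \<longleftrightarrow> is_subfield A \<and> K \<subseteq> A \<and>
     (\<forall>x\<in>A. \<exists>q. q \<noteq> 0 \<and> (\<forall>i. coeff q i \<in> K) \<and> poly q x = 0) \<and>
     (\<forall>q. (\<forall>i. coeff q i \<in> A) \<and> degree q > 0 \<longrightarrow> (\<exists>x\<in>A. poly q x = 0))"

text \<open>
  When the ambient field is complete and its absolute value \<open>vabs\<close> restricts to the \<open>p\<close>-adic absolute value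
  on the rationals (which, for a multiplicative ultrametric absolute value, is just the normalisation
  \<open>|p| = 1/p\<close>), the topological closure of the rationals is the completion \<open>\<rat>\<^sub>p\<close>,
  and its closed unit ball is \<open>\<int>\<^sub>p\<close>.
\<close>

definition Qp :: "'a::ultrametric_field set" where
  "Qp = closure \<rat>"

definition Zp :: "'a::ultrametric_field set" where
  "Zp = {x \<in> Qp. vabs x \<le> 1}"

text \<open>
  The type \<open>'a\<close> is a model of \<open>\<complex>\<^sub>p\<close>: it is a completion of an algebraic closure \<open>A\<close> of \<open>\<rat>\<^sub>p\<close>.
  Such a field is unique up to isometric isomorphism.
\<close>

definition is_Cp :: "nat \<Rightarrow> 'a::ultrametric_field itself \<Rightarrow> bool" where
  "is_Cp p _ \<longleftrightarrow> prime p \<and> vabs (of_nat p :: 'a) = 1 / real p \<and>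
     complete (UNIV :: 'a set) \<and>
     (\<exists>A :: 'a set. is_algebraic_closure_of A Qp \<and> closure A = UNIV)"

definition exp_disc :: "nat \<Rightarrow> 'a::ultrametric_field set" where
  "exp_disc p = {x. vabs x < real p powr (- 1 / (real p - 1))}"

definition scaled_exp_disc :: "nat \<Rightarrow> 'a::ultrametric_field \<Rightarrow> 'a set" where
  "scaled_exp_disc p lam = {t. lam * t \<in> exp_disc p}"

definition padic_exp :: "'a::ultrametric_field \<Rightarrow> 'a" where
  "padic_exp x = (\<Sum>n. x ^ n / fact n)"

definition padic_log :: "'a::ultrametric_field \<Rightarrow> 'a" where
  "padic_log y = (\<Sum>n. (- 1) ^ n * (y - 1) ^ Suc n / of_nat (Suc n))"

definition deg_exp :: "'a::ultrametric_field \<Rightarrow> 'a \<Rightarrow> 'a \<Rightarrow> 'a" where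
  "deg_exp lam x a = padic_exp (x / lam * padic_log (1 + lam * a))"

definition deg_cosh :: "'a::ultrametric_field \<Rightarrow> 'a \<Rightarrow> 'a \<Rightarrow> 'a" where
  "deg_cosh lam x a = (deg_exp lam x a + deg_exp lam (- x) a) / 2"

definition deg_sinh :: "'a::ultrametric_field \<Rightarrow> 'a \<Rightarrow> 'a \<Rightarrow> 'a" where
  "deg_sinh lam x a = (deg_exp lam x a - deg_exp lam (- x) a) / 2"

definition deg_coth :: "'a::ultrametric_field \<Rightarrow> 'a \<Rightarrow> 'a \<Rightarrow> 'a" where
  "deg_coth lam x a = deg_cosh lam x a / deg_sinh lam x a"

definition uniformly_differentiable_on_Zp :: "('a::ultrametric_field \<Rightarrow> 'a) \<Rightarrow> bool" where
  "uniformly_differentiable_on_Zp f \<longleftrightarrow>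
     (\<exists>f'. \<forall>e>0. \<exists>d>0. \<forall>x\<in>Zp. \<forall>y\<in>Zp. x \<noteq> y \<and> vabs (x - y) < d \<longrightarrow>
        vabs ((f x - f y) / (x - y) - f' x) < e)"

definition volkenborn_sum :: "nat \<Rightarrow> ('a::ultrametric_field \<Rightarrow> 'a) \<Rightarrow> nat \<Rightarrow> 'a" where
  "volkenborn_sum p f N = (\<Sum>x<p ^ N. f (of_nat x)) / of_nat p ^ N"

definition volkenborn_integrable :: "nat \<Rightarrow> ('a::ultrametric_field \<Rightarrow> 'a) \<Rightarrow> bool" where
  "volkenborn_integrable p f \<longleftrightarrow>
     uniformly_differentiable_on_Zp f \<and> convergent (volkenborn_sum p f)"

definition volkenborn_integral :: "nat \<Rightarrow> ('a::ultrametric_field \<Rightarrow> 'a) \<Rightarrow> 'a" where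
  "volkenborn_integral p f = lim (volkenborn_sum p f)"

end

theory Submission
  imports Defs
begin

text \<open>
  With \<open>u = log (1 + \<lambda>a) / \<lambda>\<close> one has \<open>e\<^sup>x\<^sub>\<lambda>(a) = exp (x u)\<close>, and \<open>u\<close> is a nonzero point of the disc of
  convergence of \<open>exp\<close> because \<open>|log (1 + y)| = |y|\<close> there. The Volkenborn sums of \<open>exp (x u)\<close> are
  geometric, equal to \<open>(exp (p\<^sup>N u) - 1) / (p\<^sup>N (exp u - 1))\<close>, and tend to \<open>u / (exp u - 1)\<close> because
  \<open>exp z = 1 + z + O(z\<^sup>2)\<close>. Applying this to \<open>u\<close> and \<open>- u\<close> gives both integrals. All analytic
  estimates rest on \<open>|n!| \<ge> r\<^sup>n\<^sup>-\<^sup>1\<close> for the radius \<open>r = p powr (- 1 / (p - 1))\<close>.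
\<close>

section \<open>Ultrametric fields\<close>

lemma vabs_nonneg [simp]: "0 \<le> vabs (x::'a::ultrametric_field)"
  using dist_vabs[of x 0] zero_le_dist[of x 0] by simp

lemma vabs_eq_0_iff [simp]: "vabs x = 0 \<longleftrightarrow> (x::'a::ultrametric_field) = 0"
  using dist_vabs[of x 0] by (metis diff_zero dist_eq_0_iff)

lemma vabs_zero [simp]: "vabs (0::'a::ultrametric_field) = 0"
  by simp

lemma vabs_pos_iff [simp]: "0 < vabs x \<longleftrightarrow> (x::'a::ultrametric_field) \<noteq> 0"
  using vabs_nonneg[of x] vabs_eq_0_iff[of x] by linarith

lemma vabs_one [simp]: "vabs (1::'a::ultrametric_field) = 1"
  using vabs_mult[of 1 "1::'a"] by simp

lemma vabs_minus [simp]: "vabs (- x) = vabs (x::'a::ultrametric_field)"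
  using dist_vabs[of 0 x] dist_vabs[of x 0] by (simp add: dist_commute)

lemma vabs_diff_le_max: "vabs (x - y) \<le> max (vabs x) (vabs (y::'a::ultrametric_field))"
  using vabs_add_le_max[of x "- y"] by simp

lemma vabs_power: "vabs (x ^ n) = vabs (x::'a::ultrametric_field) ^ n"
  by (induction n) (simp_all add: vabs_mult)

lemma vabs_divide: "vabs (x / y) = vabs x / vabs (y::'a::ultrametric_field)"
proof (cases "y = 0")
  case False
  then have "vabs (x / y) * vabs y = vabs x" by (simp flip: vabs_mult)
  with False show ?thesis by (simp add: field_simps)
qed simp

text \<open>Isosceles principle: the strong triangle inequality for \<open>x = (x - y) + y\<close>
  and for \<open>y = x - (x - y)\<close>. It turns a dominant term into an exact absolute
  value.\<close>

lemma vabs_eqI_diff_less: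
  fixes x y :: "'a::ultrametric_field"
  assumes "vabs (x - y) < vabs y"
  shows "vabs x = vabs y"
proof (rule antisym)
  show "vabs x \<le> vabs y" using vabs_add_le_max[of "x - y" y] assms by simp
  show "vabs y \<le> vabs x" using vabs_diff_le_max[of x "x - y"] assms by simp
qed

lemma vabs_sum_le:
  fixes f :: "'b \<Rightarrow> 'a::ultrametric_field"
  assumes "\<And>i. i \<in> A \<Longrightarrow> vabs (f i) \<le> B" and "0 \<le> B"
  shows "vabs (sum f A) \<le> B"
  using assms(1)
proof (induction A rule: infinite_finite_induct)
  case (insert x A)
  then show ?case using vabs_add_le_max[of "f x" "sum f A"] by fastforce
qed (simp_all add: assms(2))

lemma vabs_of_nat_le_1: "vabs (of_nat n :: 'a::ultrametric_field) \<le> 1"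
  using vabs_sum_le[of "{..<n}" "\<lambda>_. 1::'a" 1] by simp

lemma vabs_of_int_le_1: "vabs (of_int n :: 'a::ultrametric_field) \<le> 1"
proof (cases n rule: int_cases2)
  case (nonneg k) then show ?thesis by (simp add: vabs_of_nat_le_1)
next
  case (nonpos k) then show ?thesis by (simp add: vabs_of_nat_le_1)
qed

section \<open>Limits and series\<close>

lemma tendsto_vabs_iff:
  fixes f :: "'b \<Rightarrow> 'a::ultrametric_field"
  shows "(f \<longlongrightarrow> l) F \<longleftrightarrow> ((\<lambda>x. vabs (f x - l)) \<longlongrightarrow> 0) F"
  by (subst tendsto_dist_iff) (simp add: dist_vabs)

lemma tendsto_vabs_le:
  fixes f :: "'b \<Rightarrow> 'a::ultrametric_field"
  assumes "\<And>x. vabs (f x - l) \<le> g x" and "(g \<longlongrightarrow> 0) F"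
  shows "(f \<longlongrightarrow> l) F"
  unfolding tendsto_vabs_iff
  by (rule tendsto_sandwich[OF _ _ tendsto_const assms(2)]) (auto simp: assms(1))

text \<open>The class fixes only a metric and an absolute value; this instance and the
  multiplicative one make the generic limit rules for sums and products applicable.\<close>

instance ultrametric_field \<subseteq> topological_ab_group_add
proof
  fix a b :: 'a
  have "((\<lambda>x. fst x + snd x) \<longlongrightarrow> a + b) (nhds (a, b))"
  proof (rule tendsto_vabs_le)
    fix x :: "'a \<times> 'a"
    have "fst x + snd x - (a + b) = (fst x - a) + (snd x - b)" by simp
    then have "vabs (fst x + snd x - (a + b)) \<le> max (vabs (fst x - a)) (vabs (snd x - b))"
      by (metis vabs_add_le_max)
    then show "vabs (fst x + snd x - (a + b)) \<le> dist (fst x) a + dist (snd x) b"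
      using vabs_nonneg[of "fst x - a"] vabs_nonneg[of "snd x - b"] unfolding dist_vabs by linarith
    have "((\<lambda>x. dist (fst x) a + dist (snd x) b) \<longlongrightarrow>
        dist (fst (a, b)) a + dist (snd (a, b)) b) (nhds (a, b))"
      by (intro tendsto_intros filterlim_ident)
    then show "((\<lambda>x. dist (fst x) a + dist (snd x) b) \<longlongrightarrow> 0) (nhds (a, b))" by simp
  qed
  then show "((\<lambda>x. fst x + snd x) \<longlongrightarrow> a + b) (nhds a \<times>\<^sub>F nhds b)"
    by (simp add: nhds_prod)
next
  fix a :: 'a
  show "(uminus \<longlongrightarrow> - a) (nhds a)"
  proof (rule tendsto_vabs_le)
    show "vabs (- x - - a) \<le> dist x a" for x
      using dist_vabs[of a x] by (simp add: dist_commute)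
    have "((\<lambda>x. dist x a) \<longlongrightarrow> dist a a) (nhds a)"
      by (intro tendsto_intros filterlim_ident)
    then show "((\<lambda>x. dist x a) \<longlongrightarrow> 0) (nhds a)" by simp
  qed
qed

instance ultrametric_field \<subseteq> topological_semigroup_mult
proof
  fix a b :: 'a
  have "((\<lambda>x. fst x * snd x) \<longlongrightarrow> a * b) (nhds (a, b))"
  proof (rule tendsto_vabs_le)
    fix x :: "'a \<times> 'a"
    let ?c = "fst x - a" and ?d = "snd x - b"
    have "fst x * snd x - a * b = ?c * ?d + (a * ?d + ?c * b)" by (simp add: algebra_simps)
    then have "vabs (fst x * snd x - a * b) \<le> max (vabs (?c * ?d)) (vabs (a * ?d + ?c * b))"
      by (metis vabs_add_le_max)
    also have "\<dots> \<le> vabs (?c * ?d) + (vabs (a * ?d) + vabs (?c * b))"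
      using vabs_add_le_max[of "a * ?d" "?c * b"] vabs_nonneg[of "?c * ?d"]
        vabs_nonneg[of "a * ?d"] vabs_nonneg[of "?c * b"] by linarith
    finally show "vabs (fst x * snd x - a * b) \<le>
        dist (fst x) a * dist (snd x) b + (vabs a * dist (snd x) b + dist (fst x) a * vabs b)"
      by (simp add: dist_vabs vabs_mult)
    have "((\<lambda>x. dist (fst x) a * dist (snd x) b
          + (vabs a * dist (snd x) b + dist (fst x) a * vabs b)) \<longlongrightarrow>
        dist (fst (a, b)) a * dist (snd (a, b)) b
          + (vabs a * dist (snd (a, b)) b + dist (fst (a, b)) a * vabs b)) (nhds (a, b))"
      by (intro tendsto_intros filterlim_ident)
    then show "((\<lambda>x. dist (fst x) a * dist (snd x) b
          + (vabs a * dist (snd x) b + dist (fst x) a * vabs b)) \<longlongrightarrow> 0) (nhds (a, b))" by simp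
  qed
  then show "((\<lambda>x. fst x * snd x) \<longlongrightarrow> a * b) (nhds a \<times>\<^sub>F nhds b)"
    by (simp add: nhds_prod)
qed

lemma vabs_le_of_tendsto:
  fixes X :: "nat \<Rightarrow> 'a::ultrametric_field"
  assumes "X \<longlonglongrightarrow> l" and "eventually (\<lambda>n. vabs (X n) \<le> B) sequentially"
  shows "vabs l \<le> B"
proof (rule tendsto_upperbound[OF _ assms(2)])
  have "(\<lambda>n. dist (X n) 0) \<longlonglongrightarrow> dist l 0" by (intro tendsto_intros assms(1))
  then show "(\<lambda>n. vabs (X n)) \<longlonglongrightarrow> vabs l" by (simp add: dist_vabs)
qed simp

text \<open>A block of consecutive terms is no larger than its largest term, so terms tending to
  \<open>0\<close> already make the partial sums Cauchy.\<close>

lemma summable_ultrametric: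
  fixes f :: "nat \<Rightarrow> 'a::ultrametric_field"
  assumes "complete (UNIV :: 'a set)" and f: "(\<lambda>n. vabs (f n)) \<longlonglongrightarrow> 0"
  shows "summable f"
proof -
  let ?S = "\<lambda>n. sum f {..<n}"
  have "Cauchy ?S"
  proof (rule metric_CauchyI)
    fix e :: real assume e: "0 < e"
    then have "eventually (\<lambda>n. vabs (f n) < e / 2) sequentially"
      using order_tendstoD(2)[OF f, of "e / 2"] by simp
    then obtain M where M: "\<And>n. n \<ge> M \<Longrightarrow> vabs (f n) < e / 2"
      by (auto simp: eventually_sequentially)
    have *: "dist (?S n) (?S m) < e" if "M \<le> m" "m \<le> n" for m n
    proof -
      have "?S n - ?S m = sum f {m..<n}"
        using that sum_diff_nat_ivl[of 0 m n f] by (simp add: lessThan_atLeast0)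
      moreover have "vabs (sum f {m..<n}) \<le> e / 2"
        using that M e by (intro vabs_sum_le) (auto intro: less_imp_le)
      ultimately show ?thesis using e by (simp add: dist_vabs)
    qed
    show "\<exists>M. \<forall>m\<ge>M. \<forall>n\<ge>M. dist (?S m) (?S n) < e"
      by (rule exI[of _ M]) (metis * dist_commute nat_le_linear)
  qed
  then obtain l where "?S \<longlonglongrightarrow> l" using assms(1) unfolding complete_def by blast
  then show ?thesis by (auto simp: summable_def sums_def)
qed

text \<open>The bound on finite blocks survives the passage to the limit, so a uniform bound on the
  terms of a tail bounds the tail itself.\<close>

lemma vabs_suminf_diff_le:
  fixes f :: "nat \<Rightarrow> 'a::ultrametric_field"
  assumes "summable f" and "\<And>n. k \<le> n \<Longrightarrow> vabs (f n) \<le> B" and "0 \<le> B"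
  shows "vabs (suminf f - sum f {..<k}) \<le> B"
proof (rule vabs_le_of_tendsto)
  show "(\<lambda>n. sum f {..<n} - sum f {..<k}) \<longlonglongrightarrow> suminf f - sum f {..<k}"
    by (intro tendsto_intros summable_LIMSEQ assms(1))
  have "vabs (sum f {..<n} - sum f {..<k}) \<le> B" if "k \<le> n" for n
  proof -
    have "sum f {..<n} - sum f {..<k} = sum f {k..<n}"
      using that sum_diff_nat_ivl[of 0 k n f] by (simp add: lessThan_atLeast0)
    then show ?thesis using assms(2,3) by (auto intro!: vabs_sum_le)
  qed
  then show "eventually (\<lambda>n. vabs (sum f {..<n} - sum f {..<k}) \<le> B) sequentially"
    by (auto simp: eventually_sequentially)
qed

section \<open>Uniform differentiability on \<open>Zp\<close>\<close>

lemma uniformly_differentiable_on_Zp_add: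
  assumes "uniformly_differentiable_on_Zp f" and "uniformly_differentiable_on_Zp g"
  shows "uniformly_differentiable_on_Zp (\<lambda>x. f x + g x)"
proof -
  obtain f' where f': "\<forall>e>0. \<exists>d>0. \<forall>x\<in>Zp. \<forall>y\<in>Zp. x \<noteq> y \<and> vabs (x - y) < d \<longrightarrow>
      vabs ((f x - f y) / (x - y) - f' x) < e"
    using assms(1) unfolding uniformly_differentiable_on_Zp_def by (rule exE)
  obtain g' where g': "\<forall>e>0. \<exists>d>0. \<forall>x\<in>Zp. \<forall>y\<in>Zp. x \<noteq> y \<and> vabs (x - y) < d \<longrightarrow>
      vabs ((g x - g y) / (x - y) - g' x) < e"
    using assms(2) unfolding uniformly_differentiable_on_Zp_def by (rule exE)
  show ?thesis unfolding uniformly_differentiable_on_Zp_def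
  proof (intro exI[of _ "\<lambda>x. f' x + g' x"] allI impI)
    fix e :: real assume "e > 0"
    obtain d1 where d1: "d1 > 0" "\<And>x y. x \<in> Zp \<Longrightarrow> y \<in> Zp \<Longrightarrow> x \<noteq> y \<Longrightarrow> vabs (x - y) < d1 \<Longrightarrow>
        vabs ((f x - f y) / (x - y) - f' x) < e" using f' \<open>e > 0\<close> by meson
    obtain d2 where d2: "d2 > 0" "\<And>x y. x \<in> Zp \<Longrightarrow> y \<in> Zp \<Longrightarrow> x \<noteq> y \<Longrightarrow> vabs (x - y) < d2 \<Longrightarrow>
        vabs ((g x - g y) / (x - y) - g' x) < e" using g' \<open>e > 0\<close> by meson
    have "vabs ((f x + g x - (f y + g y)) / (x - y) - (f' x + g' x)) < e"
      if "x \<in> Zp" "y \<in> Zp" "x \<noteq> y" "vabs (x - y) < min d1 d2" for x y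
    proof -
      have "(f x + g x - (f y + g y)) / (x - y) - (f' x + g' x) =
          ((f x - f y) / (x - y) - f' x) + ((g x - g y) / (x - y) - g' x)"
        by (simp add: diff_divide_distrib add_divide_distrib)
      also have "vabs \<dots> \<le> max (vabs ((f x - f y) / (x - y) - f' x)) (vabs ((g x - g y) / (x - y) - g' x))"
        by (rule vabs_add_le_max)
      also have "\<dots> < e" using d1(2)[of x y] d2(2)[of x y] that by simp
      finally show ?thesis .
    qed
    then show "\<exists>d>0. \<forall>x\<in>Zp. \<forall>y\<in>Zp. x \<noteq> y \<and> vabs (x - y) < d \<longrightarrow>
        vabs ((f x + g x - (f y + g y)) / (x - y) - (f' x + g' x)) < e"
      using d1(1) d2(1) by (intro exI[of _ "min d1 d2"]) auto
  qed
qed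

text \<open>Dividing the second-order remainder by \<open>x - y\<close> leaves an error of at most
  \<open>C * vabs (x - y)\<close>, uniformly in both points.\<close>

lemma uniformly_differentiable_on_ZpI_quadratic:
  assumes "\<And>x y. x \<in> Zp \<Longrightarrow> y \<in> Zp \<Longrightarrow>
      vabs (f x - f y - (x - y) * f' x) \<le> C * vabs (x - y) ^ 2"
  shows "uniformly_differentiable_on_Zp f"
  unfolding uniformly_differentiable_on_Zp_def
proof (intro exI[of _ f'] allI impI)
  fix e :: real assume e: "e > 0"
  \<comment> \<open>The denominator \<open>\<bar>C\<bar> + 1\<close> is positive whatever the sign
    of \<open>C\<close>, including \<open>C = 0\<close>.\<close>
  have "vabs ((f x - f y) / (x - y) - f' x) < e"
    if xy: "x \<in> Zp" "y \<in> Zp" "x \<noteq> y" "vabs (x - y) < e / (\<bar>C\<bar> + 1)" for x y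
  proof -
    have "(f x - f y) / (x - y) - f' x = (f x - f y - (x - y) * f' x) / (x - y)"
      using xy(3) by (simp add: field_simps)
    then have "vabs ((f x - f y) / (x - y) - f' x) \<le> C * vabs (x - y) ^ 2 / vabs (x - y)"
      using assms[OF xy(1,2)] by (simp add: vabs_divide divide_right_mono)
    also have "\<dots> = C * vabs (x - y)"
      using xy(3) by (simp add: power2_eq_square)
    also have "\<dots> \<le> (\<bar>C\<bar> + 1) * vabs (x - y)"
      by (intro mult_right_mono) auto
    also have "\<dots> < e" using xy(4) by (simp add: field_simps)
    finally show ?thesis .
  qed
  then show "\<exists>d>0. \<forall>x\<in>Zp. \<forall>y\<in>Zp. x \<noteq> y \<and> vabs (x - y) < d \<longrightarrow>
      vabs ((f x - f y) / (x - y) - f' x) < e"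
    using e by (intro exI[of _ "e / (\<bar>C\<bar> + 1)"]) auto
qed

section \<open>The \<open>p\<close>-adic exponential and logarithm\<close>

locale complete_padic_field =
  fixes p :: nat and model :: "'a::ultrametric_field itself"
  assumes prime_p: "prime p"
    and vabs_p: "vabs (of_nat p :: 'a) = 1 / real p"
    and complete_UNIV: "complete (UNIV :: 'a set)"
begin

text \<open>The radius of convergence of the exponential series. The factorial estimate uses it
  through \<open>radius ^ (p - 1) = 1 / real p\<close>.\<close>

definition radius :: real where
  "radius = real p powr (- 1 / (real p - 1))"

lemma p_gt_1: "1 < real p"
  using prime_gt_1_nat[OF prime_p] by simp

lemma radius_pos: "0 < radius"
  using p_gt_1 by (simp add: radius_def)

lemma radius_le_1: "radius \<le> 1"
  using p_gt_1 powr_mono[of "- 1 / (real p - 1)" 0 "real p"] by (simp add: radius_def)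

lemma radius_power: "radius ^ (p - 1) = 1 / real p"
proof -
  have "radius ^ (p - 1) = real p powr (- 1 / (real p - 1) * real (p - 1))"
    using p_gt_1 by (simp add: radius_def powr_powr flip: powr_realpow)
  also have "- 1 / (real p - 1) * real (p - 1) = - 1"
    using p_gt_1 by (simp add: of_nat_diff)
  finally show ?thesis using p_gt_1 by (simp add: powr_minus_divide)
qed

section \<open>Absolute values of integers and factorials\<close>

lemma vabs_of_nat_coprime:
  assumes "\<not> p dvd k"
  shows "vabs (of_nat k :: 'a) = 1"
proof (rule antisym)
  have "coprime (int k) (int p)"
    using assms prime_p prime_imp_coprime_nat[of p k] by (simp add: coprime_commute)
  \<comment> \<open>In a Bezout relation the multiple of \<open>p\<close> has absolute value below
    \<open>1\<close>, so \<open>u * k\<close> has absolute value at least \<open>1\<close>; as that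
    of \<open>u\<close> is at most \<open>1\<close>, the same holds for \<open>k\<close>.\<close>
  then obtain u v where "u * int k + v * int p = 1"
    using bezout_int[of "int k" "int p"] by auto
  then have "of_int u * of_nat k + of_int v * of_nat p = (1::'a)"
    by (metis of_int_1 of_int_add of_int_mult of_int_of_nat_eq)
  then have "1 \<le> max (vabs (of_int u * of_nat k :: 'a)) (vabs (of_int v * of_nat p :: 'a))"
    by (metis vabs_add_le_max vabs_one)
  moreover have "vabs (of_int v * of_nat p :: 'a) < 1"
  proof -
    have "vabs (of_int v * of_nat p :: 'a) \<le> 1 * (1 / real p)"
      unfolding vabs_mult vabs_p by (intro mult_right_mono vabs_of_int_le_1) simp
    also have "\<dots> < 1" using p_gt_1 by simp
    finally show ?thesis .
  qed
  moreover have "vabs (of_int u * of_nat k :: 'a) \<le> 1 * vabs (of_nat k :: 'a)"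
    unfolding vabs_mult by (intro mult_right_mono vabs_of_int_le_1) simp
  ultimately show "1 \<le> vabs (of_nat k :: 'a)" by linarith
qed (rule vabs_of_nat_le_1)

text \<open>The extra factors \<open>p * m + 1, ..., p * m + j\<close> are prime to
  \<open>p\<close>, hence of absolute value \<open>1\<close>.\<close>

lemma vabs_fact_add:
  assumes "j < p"
  shows "vabs (fact (p * m + j) :: 'a) = vabs (fact (p * m) :: 'a)"
  using assms
proof (induction j)
  case (Suc j)
  have "\<not> p dvd Suc j" using Suc.prems by (auto dest: dvd_imp_le)
  then have "\<not> p dvd p * m + Suc j" by (simp add: dvd_add_right_iff del: add_Suc_right)
  then have "vabs (of_nat (p * m + Suc j) :: 'a) = 1" by (rule vabs_of_nat_coprime)
  then show ?case using Suc by (simp add: vabs_mult del: of_nat_add of_nat_Suc)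
qed simp

text \<open>The recursive form of Legendre's formula: among the \<open>p\<close> new factors between
  \<open>fact (p * m)\<close> and \<open>fact (p * Suc m)\<close>, only the last,
  \<open>p * Suc m\<close>, is divisible by \<open>p\<close>.\<close>

lemma vabs_fact_mult:
  "vabs (fact (p * m) :: 'a) = (1 / real p) ^ m * vabs (fact m :: 'a)"
proof (induction m)
  case (Suc m)
  have "Suc (p * m + (p - 1)) = p * Suc m" using prime_gt_0_nat[OF prime_p] by simp
  then have "fact (p * Suc m) = (of_nat (p * Suc m) * fact (p * m + (p - 1)) :: 'a)"
    by (metis fact_Suc)
  then have "vabs (fact (p * Suc m) :: 'a) =
      vabs (of_nat (p * Suc m) :: 'a) * vabs (fact (p * m + (p - 1)) :: 'a)"
    by (simp only: vabs_mult)
  also have "vabs (fact (p * m + (p - 1)) :: 'a) = vabs (fact (p * m) :: 'a)"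
    using prime_gt_0_nat[OF prime_p] by (intro vabs_fact_add) simp
  finally show ?case
    unfolding of_nat_mult vabs_mult vabs_p Suc.IH fact_Suc by simp
qed simp

text \<open>In terms of valuations, v_p(n!) \<le> (n - 1) / (p - 1) for n \<ge> 1. Strong induction
  through \<open>vabs_fact_mult\<close> with \<open>m = Suc n div p\<close>, each factor
  \<open>1 / p\<close> being worth \<open>p - 1\<close> powers of \<open>radius\<close>.\<close>

lemma vabs_fact_ge: "radius ^ n \<le> vabs (fact (Suc n) :: 'a)"
proof (induction n rule: less_induct)
  case (less n)
  define m where "m = Suc n div p"
  have n: "Suc n = p * m + Suc n mod p" by (simp add: m_def)
  have "vabs (fact (Suc n) :: 'a) = vabs (fact (p * m) :: 'a)"
    using vabs_fact_add[of "Suc n mod p" m] n prime_gt_0_nat[OF prime_p] by simp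
  then have eq: "vabs (fact (Suc n) :: 'a) = (1 / real p) ^ m * vabs (fact m :: 'a)"
    by (simp only: vabs_fact_mult)
  show ?case
  proof (cases m)
    case 0
    then show ?thesis using eq radius_pos radius_le_1 by (simp add: power_le_one)
  next
    case (Suc k)
    have "m < Suc n" using prime_gt_1_nat[OF prime_p] unfolding m_def by (intro div_less_dividend) auto
    then have IH: "radius ^ k \<le> vabs (fact m :: 'a)" using less.IH[of k] Suc by simp
    \<comment> \<open>Since \<open>m = Suc k\<close>, the left side is \<open>p * m - 1\<close>, and
      \<open>p * m \<le> Suc n\<close>.\<close>
    have le: "(p - 1) * m + k \<le> n"
    proof -
      have "(p - 1) * m + m = p * m" using prime_gt_0_nat[OF prime_p]
        by (cases p) auto
      then show ?thesis using n Suc by linarith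
    qed
    have "radius ^ n \<le> radius ^ ((p - 1) * m + k)"
      using radius_pos radius_le_1 le by (intro power_decreasing) auto
    also have "\<dots> = (1 / real p) ^ m * radius ^ k"
      by (simp only: power_add power_mult radius_power)
    also have "\<dots> \<le> (1 / real p) ^ m * vabs (fact m :: 'a)"
      using IH by (intro mult_left_mono) auto
    finally show ?thesis using eq by simp
  qed
qed

text \<open>\<open>fact (Suc n)\<close> is \<open>Suc n\<close> times a factorial of absolute value
  at most \<open>1\<close>. The bound is crude but lets the logarithm share the estimates of the
  exponential.\<close>

lemma vabs_of_nat_Suc_ge: "radius ^ n \<le> vabs (of_nat (Suc n) :: 'a)"
proof -
  have "vabs (fact n :: 'a) \<le> 1"
    using vabs_of_nat_le_1[of "fact n", where 'a = 'a] by simp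
  then have "vabs (of_nat (Suc n) :: 'a) * vabs (fact n :: 'a) \<le> vabs (of_nat (Suc n) :: 'a)"
    by (intro mult_left_le) auto
  then show ?thesis using vabs_fact_ge[of n] unfolding fact_Suc vabs_mult by linarith
qed

text \<open>Common majorant: \<open>c = fact (Suc n)\<close> gives the exponential terms and
  \<open>c = of_nat (Suc n)\<close>, up to sign, those of the logarithm.\<close>

lemma vabs_power_divide_le:
  fixes z c :: 'a
  assumes "radius ^ n \<le> vabs c"
  shows "vabs (z ^ Suc n / c) \<le> vabs z * (vabs z / radius) ^ n"
proof -
  have "vabs (z ^ Suc n / c) = vabs z * vabs z ^ n / vabs c"
    by (simp add: vabs_divide vabs_power vabs_mult)
  also have "\<dots> \<le> vabs z * vabs z ^ n / radius ^ n"
    using assms radius_pos by (intro divide_left_mono) (auto intro!: mult_pos_pos less_le_trans[OF _ assms])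
  finally show ?thesis by (simp add: power_divide)
qed

section \<open>The exponential series\<close>

lemma exp_disc_iff: "z \<in> exp_disc p \<longleftrightarrow> vabs z < radius" for z :: 'a
  by (simp add: exp_disc_def radius_def)

lemma exp_disc_ratio:
  fixes z :: 'a
  assumes "z \<in> exp_disc p"
  shows "0 \<le> vabs z / radius" and "vabs z / radius < 1"
  using assms radius_pos by (auto simp: exp_disc_iff)

text \<open>A pure power as majorant, valid from \<open>n = 0\<close> on, at the price of a factor
  \<open>1 / radius \<ge> 1\<close>; its multiplicative shape suits the Cauchy product.\<close>

lemma vabs_exp_term_le:
  fixes z :: 'a
  assumes "z \<in> exp_disc p"
  shows "vabs (z ^ n / fact n) \<le> (vabs z / radius) ^ n"
proof (cases n)
  case (Suc k)
  have "vabs (z ^ n / fact n) \<le> vabs z * (vabs z / radius) ^ k"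
    unfolding Suc by (rule vabs_power_divide_le[OF vabs_fact_ge])
  also have "\<dots> \<le> vabs z / radius * (vabs z / radius) ^ k"
  proof (rule mult_right_mono)
    have "vabs z * radius \<le> vabs z" using radius_le_1 by (intro mult_left_le) auto
    then show "vabs z \<le> vabs z / radius" using radius_pos by (simp add: field_simps)
  qed (use exp_disc_ratio[OF assms] in auto)
  finally show ?thesis by (simp add: Suc)
qed simp

lemma exp_summable:
  fixes z :: 'a
  assumes "z \<in> exp_disc p"
  shows "summable (\<lambda>n. z ^ n / fact n)"
proof (rule summable_ultrametric[OF complete_UNIV])
  show "(\<lambda>n. vabs (z ^ n / fact n)) \<longlonglongrightarrow> 0"
    using vabs_exp_term_le[OF assms] exp_disc_ratio[OF assms]
    by (intro tendsto_sandwich[OF _ _ tendsto_const LIMSEQ_power_zero[of "vabs z / radius"]]) auto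
qed

text \<open>Every term from index \<open>2\<close> on obeys the bound at index \<open>2\<close>,
  because \<open>vabs z / radius\<close> is below \<open>1\<close>. This remainder drives both the
  differentiability and the limit of the Volkenborn sums.\<close>

lemma vabs_exp_minus_linear_le:
  fixes z :: 'a
  assumes "z \<in> exp_disc p"
  shows "vabs (padic_exp z - 1 - z) \<le> vabs z ^ 2 / radius"
proof -
  have "vabs (suminf (\<lambda>n. z ^ n / fact n) - (\<Sum>n<2. z ^ n / fact n)) \<le> vabs z * (vabs z / radius)"
  proof (rule vabs_suminf_diff_le[OF exp_summable[OF assms]])
    fix n :: nat assume "2 \<le> n"
    then obtain k where n: "n = Suc k" "1 \<le> k" by (cases n) auto
    have "vabs (z ^ n / fact n) \<le> vabs z * (vabs z / radius) ^ k"
      unfolding n by (rule vabs_power_divide_le[OF vabs_fact_ge])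
    also have "\<dots> \<le> vabs z * (vabs z / radius) ^ 1"
      using exp_disc_ratio[OF assms] n by (intro mult_left_mono power_decreasing) auto
    finally show "vabs (z ^ n / fact n) \<le> vabs z * (vabs z / radius)" by simp
  qed (use radius_pos in auto)
  then show ?thesis
    by (simp add: padic_exp_def numeral_2_eq_2 diff_diff_eq)
qed

text \<open>For nonzero \<open>z\<close> in the disc the remainder
  \<open>vabs z ^ 2 / radius\<close> is strictly below \<open>vabs z\<close>, so the linear term
  decides. At \<open>z = 0\<close> strictness fails and the remainder bound alone settles the
  claim.\<close>

lemma vabs_exp_minus_1:
  fixes z :: 'a
  assumes "z \<in> exp_disc p"
  shows "vabs (padic_exp z - 1) = vabs z"
proof (cases "z = 0")
  case True
  then have "vabs (padic_exp z - 1) \<le> 0" using vabs_exp_minus_linear_le[OF assms] by simp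
  then show ?thesis using True vabs_nonneg[of "padic_exp z - 1"] by (metis antisym vabs_zero)
next
  case False
  have "vabs z * vabs z < vabs z * radius"
    using False assms by (simp add: exp_disc_iff)
  then have "vabs z ^ 2 / radius < vabs z"
    using radius_pos by (simp add: field_simps power2_eq_square)
  then show ?thesis
    using vabs_exp_minus_linear_le[OF assms] by (intro vabs_eqI_diff_less) linarith
qed

lemma vabs_exp:
  fixes z :: 'a
  assumes "z \<in> exp_disc p"
  shows "vabs (padic_exp z) = 1"
proof -
  have "vabs (padic_exp z - 1) < vabs (1::'a)"
    using assms radius_le_1 by (simp add: vabs_exp_minus_1 exp_disc_iff)
  then have "vabs (padic_exp z) = vabs (1::'a)" by (rule vabs_eqI_diff_less)
  then show ?thesis by simp
qed

lemma exp_zero: "padic_exp (0::'a) = 1"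
proof -
  have "vabs (padic_exp (0::'a) - 1) = vabs (0::'a)"
    using radius_pos by (intro vabs_exp_minus_1) (simp add: exp_disc_iff)
  then show ?thesis by (simp only: vabs_zero vabs_eq_0_iff right_minus_eq)
qed

lemma exp_disc_add:
  fixes x y :: 'a
  assumes "x \<in> exp_disc p" and "y \<in> exp_disc p"
  shows "x + y \<in> exp_disc p"
  using assms vabs_add_le_max[of x y] by (simp add: exp_disc_iff)

lemma exp_disc_mult:
  fixes x u :: 'a
  assumes "u \<in> exp_disc p" and "vabs x \<le> 1"
  shows "x * u \<in> exp_disc p"
proof -
  have "vabs (x * u) \<le> vabs u" unfolding vabs_mult using assms(2) by (intro mult_left_le_one_le) auto
  then show ?thesis using assms(1) by (simp add: exp_disc_iff)
qed

text \<open>Truncated Cauchy product: \<open>S x n * S y n\<close> sums over a square of index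
  pairs, \<open>S (x + y) n\<close> over the triangle \<open>i + j < n\<close>. The pairs left over
  give terms of size at most \<open>q ^ n\<close>, and so is their sum, however many there
  are.\<close>

lemma exp_add:
  fixes x y :: 'a
  assumes x: "x \<in> exp_disc p" and y: "y \<in> exp_disc p"
  shows "padic_exp (x + y) = padic_exp x * padic_exp y"
proof -
  define S where "S z n = (\<Sum>k<n. z ^ k / fact k)" for z :: 'a and n
  define q where "q = max (vabs x / radius) (vabs y / radius)"
  have q: "0 \<le> q" "q < 1" using exp_disc_ratio[OF x] exp_disc_ratio[OF y] by (auto simp: q_def)
  have lim: "S z \<longlonglongrightarrow> padic_exp z" if "z \<in> exp_disc p" for z
    using summable_LIMSEQ[OF exp_summable[OF that]] unfolding S_def padic_exp_def .
  have term_le: "vabs (x ^ k / fact k) \<le> q ^ k" "vabs (y ^ k / fact k) \<le> q ^ k" for k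
    using vabs_exp_term_le[OF x, of k] vabs_exp_term_le[OF y, of k] exp_disc_ratio[OF x]
      exp_disc_ratio[OF y]
    by (auto simp: q_def intro: order_trans[OF _ power_mono])
  have diff_le: "vabs (S x n * S y n - S (x + y) n) \<le> q ^ n" for n
  proof -
    let ?t = "\<lambda>(i, j). (x ^ i / fact i) * (y ^ j / fact j)"
    let ?Q = "{..<n} \<times> {..<n}" and ?T = "{(i, j). i + j < n}"
    have sub: "?T \<subseteq> ?Q" by auto
    \<comment> \<open>The binomial theorem spreads each term over one antidiagonal
      \<open>i + j = k\<close> of the triangle.\<close>
    have "S (x + y) n = (\<Sum>k<n. \<Sum>i\<le>k. (x ^ i / fact i) * (y ^ (k - i) / fact (k - i)))"
      unfolding S_def
    proof (intro sum.cong refl)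
      fix k
      have "(x + y) ^ k / fact k = (\<Sum>i\<le>k. of_nat (k choose i) * x ^ i * y ^ (k - i) / fact k)"
        by (simp add: binomial_ring sum_divide_distrib)
      also have "\<dots> = (\<Sum>i\<le>k. (x ^ i / fact i) * (y ^ (k - i) / fact (k - i)))"
        by (intro sum.cong refl) (simp add: binomial_fact field_simps)
      finally show "(x + y) ^ k / fact k = \<dots>" .
    qed
    also have "\<dots> = sum ?t ?T"
      by (simp add: sum.triangle_reindex)
    finally have "S x n * S y n - S (x + y) n = sum ?t ?Q - sum ?t ?T"
      by (simp add: S_def sum_product sum.cartesian_product)
    also have "\<dots> = sum ?t (?Q - ?T)"
      using sub by (simp add: sum_diff)
    also have "vabs \<dots> \<le> q ^ n"
    proof (rule vabs_sum_le)
      fix ij assume "ij \<in> ?Q - ?T"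
      then obtain i j where ij: "ij = (i, j)" "n \<le> i + j" by auto
      have "vabs (?t ij) \<le> q ^ i * q ^ j"
        unfolding ij prod.case vabs_mult using term_le q by (intro mult_mono) auto
      also have "\<dots> \<le> q ^ n" using q ij by (simp add: power_decreasing flip: power_add)
      finally show "vabs (?t ij) \<le> q ^ n" .
    qed (use q in simp)
    finally show ?thesis .
  qed
  have "(\<lambda>n. S x n * S y n - S (x + y) n) \<longlonglongrightarrow> 0"
    using diff_le by (intro tendsto_vabs_le[OF _ LIMSEQ_power_zero[of q]]) (use q in auto)
  moreover have "(\<lambda>n. S x n * S y n - S (x + y) n) \<longlonglongrightarrow>
      padic_exp x * padic_exp y - padic_exp (x + y)"
    by (intro tendsto_intros lim x y exp_disc_add)
  ultimately have "0 = padic_exp x * padic_exp y - padic_exp (x + y)" by (rule LIMSEQ_unique)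
  then show ?thesis by simp
qed

lemma exp_minus:
  fixes z :: 'a
  assumes "z \<in> exp_disc p"
  shows "padic_exp (- z) = 1 / padic_exp z"
proof -
  have "- z \<in> exp_disc p" using assms by (simp add: exp_disc_iff)
  then have "padic_exp (- z) * padic_exp z = 1"
    using exp_add[of "- z" z] assms exp_zero by simp
  then show ?thesis by (metis mult_zero_right nonzero_eq_divide_eq zero_neq_one)
qed

lemma exp_of_nat_mult:
  fixes u :: 'a
  assumes "u \<in> exp_disc p"
  shows "padic_exp (of_nat n * u) = padic_exp u ^ n"
proof (induction n)
  case (Suc n)
  have "of_nat n * u \<in> exp_disc p" by (rule exp_disc_mult[OF assms vabs_of_nat_le_1])
  then show ?case using exp_add[OF assms] Suc by (simp add: distrib_right)
qed (simp add: exp_zero)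

section \<open>The logarithm\<close>

lemma vabs_log:
  fixes y :: 'a
  assumes "y \<in> exp_disc p"
  shows "vabs (padic_log (1 + y)) = vabs y"
proof (cases "y = 0")
  case True
  then show ?thesis by (simp add: padic_log_def)
next
  case False
  let ?q = "vabs y / radius"
  let ?t = "\<lambda>n. (- 1) ^ n * y ^ Suc n / of_nat (Suc n) :: 'a"
  have t_le: "vabs (?t n) \<le> vabs y * ?q ^ n" for n
  proof -
    have "vabs (?t n) = vabs (y ^ Suc n / of_nat (Suc n))"
      by (simp add: vabs_mult vabs_divide vabs_power del: of_nat_Suc)
    then show ?thesis using vabs_power_divide_le[OF vabs_of_nat_Suc_ge, of y n] by simp
  qed
  have "(\<lambda>n. vabs y * ?q ^ n) \<longlonglongrightarrow> vabs y * 0"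
    using exp_disc_ratio[OF assms] by (intro tendsto_intros LIMSEQ_power_zero) auto
  then have "(\<lambda>n. vabs y * ?q ^ n) \<longlonglongrightarrow> 0" by simp
  then have "(\<lambda>n. vabs (?t n)) \<longlonglongrightarrow> 0"
    by (rule tendsto_sandwich[OF _ _ tendsto_const, rotated 2]) (use t_le in \<open>auto intro!: always_eventually\<close>)
  then have "summable ?t" by (rule summable_ultrametric[OF complete_UNIV])
  \<comment> \<open>Index \<open>0\<close> is the linear term \<open>y\<close>; all later terms are
    smaller by at least the factor \<open>?q < 1\<close>, so \<open>y\<close> dominates.\<close>
  then have "vabs (suminf ?t - sum ?t {..<1}) \<le> vabs y * ?q"
  proof (rule vabs_suminf_diff_le)
    fix n :: nat assume "1 \<le> n"
    then have "vabs y * ?q ^ n \<le> vabs y * ?q ^ 1"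
      using exp_disc_ratio[OF assms] by (intro mult_left_mono power_decreasing) auto
    then show "vabs (?t n) \<le> vabs y * ?q" using t_le[of n] by simp
  qed (use radius_pos in auto)
  moreover have "vabs y * ?q < vabs y * 1"
    using False exp_disc_ratio[OF assms] by (intro mult_strict_left_mono) auto
  ultimately have "vabs (padic_log (1 + y) - y) < vabs y"
    by (simp add: padic_log_def)
  then show ?thesis by (rule vabs_eqI_diff_less)
qed

section \<open>Volkenborn integrals of exponentials\<close>

text \<open>The derivative is \<open>c * u * padic_exp (x * u)\<close>. Additivity splits off
  \<open>padic_exp (x * u)\<close>, of absolute value \<open>1\<close>, so the quadratic remainder
  bound is uniform in \<open>x\<close>.\<close>

lemma uniformly_differentiable_exp:
  fixes u c :: 'a
  assumes "u \<in> exp_disc p"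
  shows "uniformly_differentiable_on_Zp (\<lambda>x. c * padic_exp (x * u))"
proof (rule uniformly_differentiable_on_ZpI_quadratic)
  fix x y :: 'a assume "x \<in> Zp" "y \<in> Zp"
  then have xu: "x * u \<in> exp_disc p" and hu: "(y - x) * u \<in> exp_disc p"
    using assms vabs_diff_le_max[of y x] by (auto simp: Zp_def intro!: exp_disc_mult)
  have "padic_exp (y * u) = padic_exp (x * u) * padic_exp ((y - x) * u)"
    using exp_add[OF xu hu] by (simp add: algebra_simps)
  then have "c * padic_exp (x * u) - c * padic_exp (y * u) - (x - y) * (c * u * padic_exp (x * u))
      = - (c * padic_exp (x * u) * (padic_exp ((y - x) * u) - 1 - (y - x) * u))"
    by (simp add: algebra_simps)
  then have "vabs (c * padic_exp (x * u) - c * padic_exp (y * u) - (x - y) * (c * u * padic_exp (x * u)))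
      = vabs c * vabs (padic_exp ((y - x) * u) - 1 - (y - x) * u)"
    by (simp add: vabs_mult vabs_exp[OF xu])
  also have "\<dots> \<le> vabs c * (vabs ((y - x) * u) ^ 2 / radius)"
    by (intro mult_left_mono vabs_exp_minus_linear_le hu) simp
  also have "vabs ((y - x) * u) = vabs (x - y) * vabs u"
    using vabs_minus[of "x - y"] by (simp add: vabs_mult)
  finally show "vabs (c * padic_exp (x * u) - c * padic_exp (y * u) - (x - y) * (c * u * padic_exp (x * u)))
      \<le> (vabs c * vabs u ^ 2 / radius) * vabs (x - y) ^ 2"
    by (simp add: power_mult_distrib mult_ac)
qed

text \<open>Division by \<open>p ^ N\<close> makes the numerator of the geometric sum a difference
  quotient of the exponential at \<open>0\<close>.\<close>

lemma volkenborn_sum_exp_tendsto: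
  fixes u :: 'a
  assumes u: "u \<in> exp_disc p" and "u \<noteq> 0"
  shows "volkenborn_sum p (\<lambda>x. padic_exp (x * u)) \<longlonglongrightarrow> u / (padic_exp u - 1)"
proof -
  have ne: "padic_exp u \<noteq> 1" using vabs_exp_minus_1[OF u] assms(2) by auto
  let ?h = "\<lambda>N. of_nat p ^ N :: 'a"
  have h_ne: "?h N \<noteq> 0" for N using prime_gt_0_nat[OF prime_p] by simp
  have "(\<lambda>N. (padic_exp (?h N * u) - 1) / ?h N) \<longlonglongrightarrow> u"
  proof (rule tendsto_vabs_le)
    fix N
    have h1: "vabs (?h N) \<le> 1" using vabs_of_nat_le_1[of "p ^ N", where 'a = 'a] by simp
    have "(padic_exp (?h N * u) - 1) / ?h N - u = (padic_exp (?h N * u) - 1 - ?h N * u) / ?h N"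
      using h_ne[of N] by (simp add: field_simps)
    then have "vabs ((padic_exp (?h N * u) - 1) / ?h N - u) \<le> vabs (?h N * u) ^ 2 / radius / vabs (?h N)"
      using vabs_exp_minus_linear_le[OF exp_disc_mult[OF u h1]]
      by (simp only: vabs_divide divide_right_mono vabs_nonneg)
    \<comment> \<open>One of the two powers of \<open>vabs (?h N)\<close> cancels; the other tends
      to \<open>0\<close>.\<close>
    also have "\<dots> = vabs u ^ 2 / radius * vabs (?h N)"
      using h_ne[of N] by (simp add: vabs_mult power_mult_distrib power2_eq_square)
    also have "vabs (?h N) = (1 / real p) ^ N" by (simp add: vabs_power vabs_p)
    finally show "vabs ((padic_exp (?h N * u) - 1) / ?h N - u) \<le> vabs u ^ 2 / radius * (1 / real p) ^ N" .
  next
    have "(\<lambda>N. vabs u ^ 2 / radius * (1 / real p) ^ N) \<longlonglongrightarrow> vabs u ^ 2 / radius * 0"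
      using p_gt_1 by (intro tendsto_mult tendsto_const LIMSEQ_power_zero) auto
    then show "(\<lambda>N. vabs u ^ 2 / radius * (1 / real p) ^ N) \<longlonglongrightarrow> 0" by simp
  qed
  then have "(\<lambda>N. (padic_exp (?h N * u) - 1) / ?h N * (1 / (padic_exp u - 1)))
      \<longlonglongrightarrow> u * (1 / (padic_exp u - 1))"
    by (intro tendsto_intros)
  \<comment> \<open>The geometric sum has ratio \<open>padic_exp u\<close>; its power
    \<open>padic_exp u ^ p ^ N\<close> is folded back into the exponential at
    \<open>p ^ N * u\<close>.\<close>
  moreover have "volkenborn_sum p (\<lambda>x. padic_exp (x * u)) =
      (\<lambda>N. (padic_exp (?h N * u) - 1) / ?h N * (1 / (padic_exp u - 1)))"
    using ne
    by (simp add: fun_eq_iff volkenborn_sum_def exp_of_nat_mult[OF u] geometric_sum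
        flip: exp_of_nat_mult[OF u, of "p ^ _", simplified])
  ultimately show ?thesis by simp
qed

text \<open>With \<open>v = - u\<close>, \<open>c = 1 / 2\<close> and \<open>d\<close> equal to
  \<open>1 / 2\<close> or \<open>- 1 / 2\<close>, this covers both hyperbolic functions.\<close>

lemma volkenborn_exp_combination:
  fixes u v c d :: 'a
  assumes u: "u \<in> exp_disc p" "u \<noteq> 0" and v: "v \<in> exp_disc p" "v \<noteq> 0"
  defines "f \<equiv> \<lambda>x. c * padic_exp (x * u) + d * padic_exp (x * v)"
  shows "volkenborn_integrable p f"
    and "volkenborn_integral p f = c * (u / (padic_exp u - 1)) + d * (v / (padic_exp v - 1))"
proof -
  have "(\<lambda>N. c * volkenborn_sum p (\<lambda>x. padic_exp (x * u)) N
        + d * volkenborn_sum p (\<lambda>x. padic_exp (x * v)) N)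
      \<longlonglongrightarrow> c * (u / (padic_exp u - 1)) + d * (v / (padic_exp v - 1))"
    by (intro tendsto_intros volkenborn_sum_exp_tendsto u v)
  moreover have "volkenborn_sum p f = (\<lambda>N. c * volkenborn_sum p (\<lambda>x. padic_exp (x * u)) N
        + d * volkenborn_sum p (\<lambda>x. padic_exp (x * v)) N)"
    by (simp add: fun_eq_iff f_def volkenborn_sum_def sum.distrib sum_distrib_left add_divide_distrib)
  ultimately have lim: "volkenborn_sum p f
      \<longlonglongrightarrow> c * (u / (padic_exp u - 1)) + d * (v / (padic_exp v - 1))" by simp
  then show "volkenborn_integral p f = c * (u / (padic_exp u - 1)) + d * (v / (padic_exp v - 1))"
    unfolding volkenborn_integral_def by (rule limI)
  show "volkenborn_integrable p f"
    unfolding volkenborn_integrable_def using lim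
    by (auto simp: f_def convergent_def
        intro!: uniformly_differentiable_on_Zp_add uniformly_differentiable_exp u v)
qed

end

section \<open>The degenerate hyperbolic functions\<close>

theorem theorem4:
  fixes p :: nat and lam a :: "'a::ultrametric_field"
  assumes "prime p" and "odd p"
    and "is_Cp p TYPE('a)"
    and "vabs lam \<ge> 1"
    and "a \<in> scaled_exp_disc p lam"
    and "a \<noteq> 0"
  shows "volkenborn_integrable p (\<lambda>x. deg_cosh lam x a) \<and>
         lam * a / padic_log (1 + lam * a) * volkenborn_integral p (\<lambda>x. deg_cosh lam x a)
           = a / 2 * deg_coth lam (1 / 2) a \<and>
         volkenborn_integrable p (\<lambda>x. deg_sinh lam x a) \<and>
         lam * a / padic_log (1 + lam * a) * volkenborn_integral p (\<lambda>x. deg_sinh lam x a)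
           = - (a / 2)"
proof -
  interpret complete_padic_field p "TYPE('a)"
    using assms(3) by unfold_locales (auto simp: is_Cp_def)
  define u where "u = padic_log (1 + lam * a) / lam"
  \<comment> \<open>\<open>w\<close> is the degenerate exponential at \<open>1 / 2\<close>; since
    \<open>padic_exp u = w ^ 2\<close>, the integrals and the hyperbolic cotangent at
    \<open>1 / 2\<close> become rational in \<open>w\<close>, with coefficients in
    \<open>u\<close>.\<close>
  define w where "w = padic_exp (u / 2)"
  have lam: "lam \<noteq> 0" using assms(4) by auto
  have y: "lam * a \<in> exp_disc p" using assms(5) by (simp add: scaled_exp_disc_def)
  have vabs_u: "vabs u = vabs a"
    using vabs_log[OF y] lam by (simp add: u_def vabs_divide vabs_mult)
  then have u0: "u \<noteq> 0" using assms(6) by auto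
  \<comment> \<open>Here \<open>vabs lam \<ge> 1\<close> enters: \<open>u\<close>, of the same size
    as \<open>a\<close>, is no larger than \<open>lam * a\<close> and stays in the disc.\<close>
  have "vabs a \<le> vabs (lam * a)"
    using mult_right_mono[OF assms(4) vabs_nonneg[of a]] by (simp add: vabs_mult)
  then have u: "u \<in> exp_disc p" using y vabs_u by (simp add: exp_disc_iff)
  then have mu: "- u \<in> exp_disc p" by (simp add: exp_disc_iff)
  \<comment> \<open>For odd \<open>p\<close> the number \<open>2\<close> has absolute value
    \<open>1\<close>, so halving \<open>u\<close> does not leave the disc.\<close>
  have "\<not> p dvd 2"
    using assms(1,2) by (metis primes_dvd_imp_eq two_is_prime_nat even_numeral)
  then have "vabs (2::'a) = 1" using vabs_of_nat_coprime[of 2] by simp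
  then have u2: "u / 2 \<in> exp_disc p" using u by (simp add: exp_disc_iff vabs_divide)
  have exp_u: "padic_exp u = w ^ 2"
    using exp_add[OF u2 u2] by (simp add: w_def power2_eq_square)
  have exp_mu: "padic_exp (- u) = 1 / w ^ 2" using exp_minus[OF u] exp_u by simp
  have w0: "w \<noteq> 0" using vabs_exp[OF u2] by (auto simp: w_def)
  have w1: "w ^ 2 \<noteq> 1" using vabs_exp_minus_1[OF u] u0 exp_u by auto
  have deg_exp: "deg_exp lam x a = padic_exp (x * u)" for x
    by (simp add: deg_exp_def u_def)
  have quot: "lam * a / padic_log (1 + lam * a) = a / u"
    using lam by (simp add: u_def)
  have cosh: "(\<lambda>x. deg_cosh lam x a) = (\<lambda>x. 1 / 2 * padic_exp (x * u) + 1 / 2 * padic_exp (x * - u))"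
    by (simp add: fun_eq_iff deg_cosh_def deg_exp add_divide_distrib)
  have sinh: "(\<lambda>x. deg_sinh lam x a) = (\<lambda>x. 1 / 2 * padic_exp (x * u) + (- 1 / 2) * padic_exp (x * - u))"
    by (simp add: fun_eq_iff deg_sinh_def deg_exp diff_divide_distrib)
  \<comment> \<open>The contribution of \<open>v = - u\<close>, with numerator and denominator
    multiplied by \<open>- w ^ 2\<close>.\<close>
  have int_minus: "- u / (padic_exp (- u) - 1) = u * w ^ 2 / (w ^ 2 - 1)"
  proof -
    have "padic_exp (- u) - 1 = - ((w ^ 2 - 1) / w ^ 2)"
      using w0 by (simp add: exp_mu diff_divide_distrib)
    then show ?thesis by simp
  qed
  have coth: "deg_coth lam (1 / 2) a = (w ^ 2 + 1) / (w ^ 2 - 1)"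
  proof -
    have "deg_coth lam (1 / 2) a = ((w + 1 / w) / 2) / ((w - 1 / w) / 2)"
      using exp_minus[OF u2] by (simp add: deg_coth_def deg_cosh_def deg_sinh_def deg_exp w_def)
    also have "\<dots> = ((w ^ 2 + 1) / w) / ((w ^ 2 - 1) / w)"
      using w0 by (simp add: add_divide_distrib diff_divide_distrib power2_eq_square)
    finally show ?thesis using w0 by simp
  qed
  have u0': "- u \<noteq> 0" using u0 by simp
  note comb = volkenborn_exp_combination[OF u u0 mu u0']
  have t0: "w ^ 2 - 1 \<noteq> 0" using w1 by simp
  \<comment> \<open>The variable \<open>t\<close> stands for \<open>w ^ 2 - 1\<close> and
    \<open>W\<close> for \<open>w ^ 2\<close>, so that the denominator is atomic for
    \<open>field_simps\<close>.\<close>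
  have cosh_eq: "a / u * (1 / 2 * (u / t) + 1 / 2 * (u * W / t)) = a / 2 * ((W + 1) / t)"
    if "t \<noteq> 0" for t W :: 'a
    using u0 that by (simp add: field_simps)
  \<comment> \<open>Writing \<open>w ^ 2\<close> as \<open>t + 1\<close> shows the cancellation: the
    two fractions differ by exactly \<open>- u\<close>, so \<open>w\<close> disappears.\<close>
  have "a / u * (1 / 2 * (u / t) + - 1 / 2 * (u * (t + 1) / t)) = - (a / 2)"
    if "t \<noteq> 0" for t :: 'a
    using u0 that by (simp add: field_simps)
  from this[OF t0] have sinh_eq:
      "a / u * (1 / 2 * (u / (w ^ 2 - 1)) + - 1 / 2 * (u * w ^ 2 / (w ^ 2 - 1))) = - (a / 2)"
    by (simp only: diff_add_cancel)
  show ?thesis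
    unfolding quot coth cosh sinh comb(2) int_minus exp_u
    using comb(1) cosh_eq[OF t0] sinh_eq by blast
qed

end
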